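(* Let $0<A<1$ and let $f(\boldsymbol{x})=|x_1-x_2|^{-A}h(\boldsymbol{x})$ for $\boldsymbol{x}=(x_1,x_2)\in[0,1]^2$, where $h$ and its first two derivatives (that is, $h$ and all of its partial derivatives of order one and two) are bounded on $[0,1]^2$. Then the function $$g(\boldsymbol{u})=f\bigl((1-u_1)\sqrt{u_2},\sqrt{u_2}\bigr),\qquad \boldsymbol{u}=(u_1,u_2)\in[0,1]^2,$$ has a lower edge singularity no worse than $u_1^{-A_1}u_2^{-A_2}$ with $A_1=A$ and $A_2=A/2$.
   Context: A function $g(\boldsymbol{u})$ defined on $[0,1]^d$ has a lower edge singularity no worse than $\prod_{j=1}^d u_j^{-A_j}$, for constants $0<A_j<1$, if there is a constant $B<\infty$ such that for all subsets $v\subseteq\{1,2,\dots,d\}$ $$|\partial^v g(\boldsymbol{u})|\le B\prod_{j=1}^d u_j^{-A_j-1_{j\in v}},$$ where $\partial^v g$ denotes the mixed partial derivative of $g$ taken once with respect to each $u_j$ with $j\in v$ (so $\partial^\emptyset g=g$), and $1_{j\in v}$ equals $1$ if $j\in v$ and $0$ otherwise. The bound is required at points with all $u_j>0$; the singular functions $f$ and $g$ need not be finite where $x_1=x_2$, respectively where $u_1u_2=0$. Here $d=2$.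
   Formalization: "h and its first two derivatives" is read as: h is twice (Fréchet) differentiable on the closed square, with bounded partial derivatives up to order two; mere existence of bounded partials would not make the mixed derivative of g exist in both orders. *)

theory Defs
  imports "HOL-Analysis.Analysis"
begin

definition upd_coord :: "real ^ 'n \<Rightarrow> 'n::finite \<Rightarrow> real \<Rightarrow> real ^ 'n" where
  "upd_coord u j t = (\<chi> i. if i = j then t else u $ i)"

text \<open>The derivative is taken along the part of the coordinate line that lies in \<open>S\<close>; hence it is
  one-sided at those boundary points of a box that are extreme in direction \<open>j\<close>.\<close>

definition has_partial_on ::
    "(real ^ 'n) set \<Rightarrow> 'n::finite \<Rightarrow> (real ^ 'n \<Rightarrow> real) \<Rightarrow> (real ^ 'n \<Rightarrow> real) \<Rightarrow> bool" where
  "has_partial_on S j g g' \<longleftrightarrow>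
     (\<forall>u\<in>S. ((\<lambda>t. g (upd_coord u j t)) has_real_derivative g' u)
              (at (u $ j) within {t. upd_coord u j t \<in> S}))"

text \<open>Iterated partial derivatives along a list of coordinates, the head of the list being
  differentiated first.\<close>

primrec has_partials_on ::
    "(real ^ 'n) set \<Rightarrow> 'n::finite list \<Rightarrow> (real ^ 'n \<Rightarrow> real) \<Rightarrow> (real ^ 'n \<Rightarrow> real) \<Rightarrow> bool" where
  "has_partials_on S [] g D \<longleftrightarrow> (\<forall>u\<in>S. D u = g u)"
| "has_partials_on S (j # js) g D \<longleftrightarrow>
     (\<exists>g'. has_partial_on S j g g' \<and> has_partials_on S js g' D)"

text \<open>\<open>D v\<close> is the mixed partial derivative of \<open>g\<close> taken once in each coordinate of \<open>v\<close>; it has to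
  exist, with the same value, for every order of differentiation. Values of \<open>g\<close> at points with
  some coordinate equal to zero are irrelevant.\<close>

definition lower_edge_singularity :: "real ^ 'n::finite \<Rightarrow> (real ^ 'n \<Rightarrow> real) \<Rightarrow> bool" where
  "lower_edge_singularity A g \<longleftrightarrow>
     (\<forall>j. 0 < A $ j \<and> A $ j < 1) \<and>
     (let Q = {u. \<forall>j. 0 < u $ j \<and> u $ j \<le> 1} in
      \<exists>B D. \<forall>v.
        (\<forall>js. distinct js \<and> set js = v \<longrightarrow> has_partials_on Q js g (D v)) \<and>
        (\<forall>u\<in>Q. \<bar>D v u\<bar> \<le> B * (\<Prod>j\<in>UNIV. u $ j powr (- A $ j - of_bool (j \<in> v)))))"

definition twice_differentiable_on :: "(real ^ 'n::finite \<Rightarrow> real) \<Rightarrow> (real ^ 'n) set \<Rightarrow> bool" where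
  "twice_differentiable_on h S \<longleftrightarrow>
     (\<exists>h'. (\<forall>x\<in>S. (h has_derivative blinfun_apply (h' x)) (at x within S)) \<and>
           h' differentiable_on S)"

text \<open>Twice differentiability (in the sense of Frechet, without continuity of the second
  derivative) is part of the definition: mere existence and boundedness of the partial derivatives
  up to order two would not yield a chain rule for the first-order partial derivatives.\<close>

definition bounded_derivs_upto_2 :: "(real ^ 'n::finite \<Rightarrow> real) \<Rightarrow> (real ^ 'n) set \<Rightarrow> bool" where
  "bounded_derivs_upto_2 h S \<longleftrightarrow>
     twice_differentiable_on h S \<and>
     (\<forall>js. length js \<le> 2 \<longrightarrow> (\<exists>D. has_partials_on S js h D \<and> bounded (D ` S)))"

end

theory Submission
  imports Defs
begin

text \<open>
  At the point \<open>(x\<^sub>1, x\<^sub>2) = ((1 - u\<^sub>1) \<surd>u\<^sub>2, \<surd>u\<^sub>2)\<close> the distance to the diagonal is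
  \<open>x\<^sub>2 - x\<^sub>1 = u\<^sub>1 \<surd>u\<^sub>2\<close>, so that for \<open>u\<^sub>1, u\<^sub>2 > 0\<close>

    \<open>g u = u\<^sub>1 powr (- A) * u\<^sub>2 powr (- A / 2) * h (x\<^sub>1, x\<^sub>2)\<close>.

  The singular factor is a product of powers of the coordinates with exactly the exponents of the
  claim. Differentiating such a weight in direction \<open>j\<close> lowers the exponent of \<open>u\<^sub>j\<close> by one, and
  the product rule then gives the general principle \<open>has_partial_on_edge_weight_mult\<close>: a weight
  times a function \<open>k\<close> has as its partial derivative the next weight times
  \<open>u\<^sub>j \<partial>\<^sub>j k - A\<^sub>j k\<close>. Hence it suffices to bound the functions that arise from \<open>h (x\<^sub>1, x\<^sub>2)\<close> by the
  operators \<open>u\<^sub>j \<partial>\<^sub>j - A\<^sub>j\<close>. The only unbounded quantity that the chain rule produces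
  (\<open>has_partial_on_pullback\<close>) is the derivative \<open>1 / (2 \<surd>u\<^sub>2)\<close> of the square root, and the factor
  \<open>u\<^sub>2\<close> in \<open>u\<^sub>2 \<partial>\<^sub>2\<close> absorbs it.

  The mixed derivative has to exist with the same value for both orders of differentiation. The two
  expressions differ exactly by an exchange of the mixed second derivatives of \<open>h\<close>, and these have to
  agree also at boundary points of the square, which the image of the transformation contains.
  As the second derivatives need not be continuous, this is deduced from twofold Frechet
  differentiability alone, in the one-sided form \<open>second_derivative_symmetric_within\<close>.
\<close>

section \<open>Symmetry of second derivatives relative to a set\<close>

text \<open>The second difference is the increment, as \<open>s\<close> runs from \<open>0\<close> to \<open>t\<close>, of the difference of \<open>h\<close> on
  two parallel edges in direction \<open>d\<close>. The mean value theorem turns it into \<open>t\<close> times a difference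
  of two values of \<open>\<lambda>x. h' x d\<close>, and the linear approximation of that function at \<open>a\<close> evaluates this
  difference as \<open>t * L k + o(t)\<close>. Only the parallelogram spanned by \<open>d\<close> and \<open>k\<close> has to lie in \<open>S\<close>,
  so \<open>a\<close> may be a boundary point.\<close>

lemma second_difference_limit:
  fixes h :: "'a::real_normed_vector \<Rightarrow> real"
  assumes der: "\<And>x. x \<in> S \<Longrightarrow> (h has_derivative h' x) (at x within S)"
    and der2: "((\<lambda>x. h' x d) has_derivative L) (at a within S)"
    and par: "\<And>s t. \<lbrakk>0 \<le> s; s \<le> 1; 0 \<le> t; t \<le> 1\<rbrakk> \<Longrightarrow> a + s *\<^sub>R d + t *\<^sub>R k \<in> S"
  shows "((\<lambda>t. (h (a + t *\<^sub>R d + t *\<^sub>R k) - h (a + t *\<^sub>R d) - h (a + t *\<^sub>R k) + h a) / t\<^sup>2)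
           \<longlongrightarrow> L k) (at_right 0)"
proof (rule tendstoI)
  fix e :: real
  assume "e > 0"
  define c where "c = 2 * norm d + norm k + 1"
  have c: "c > 0"
    by (simp add: c_def add_nonneg_pos)
  define \<epsilon> where "\<epsilon> = e / c"
  have \<epsilon>: "\<epsilon> > 0"
    using c \<open>e > 0\<close> by (simp add: \<epsilon>_def)
  interpret L: bounded_linear L
    using der2 by (rule has_derivative_bounded_linear)
  obtain \<delta> where \<delta>: "\<delta> > 0"
    and near: "\<And>y. \<lbrakk>y \<in> S; norm (y - a) < \<delta>\<rbrakk> \<Longrightarrow> \<bar>h' y d - h' a d - L (y - a)\<bar> \<le> \<epsilon> * norm (y - a)"
    using der2 \<epsilon> unfolding has_derivative_within_alt real_norm_def by blast
  have "eventually (\<lambda>t::real. t < min 1 (\<delta> / c)) (at_right 0)"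
    using \<delta> c by (intro eventually_at_right_less eventually_at_rightI[of 0 "min 1 (\<delta>/c)"]) auto
  moreover have "eventually (\<lambda>t::real. t > 0) (at_right 0)"
    by (simp add: eventually_at_right_less)
  ultimately show "eventually (\<lambda>t. dist ((h (a + t *\<^sub>R d + t *\<^sub>R k) - h (a + t *\<^sub>R d)
      - h (a + t *\<^sub>R k) + h a) / t\<^sup>2) (L k) < e) (at_right 0)"
  proof eventually_elim
    case (elim t)
    then have t: "0 < t" "t < 1" "t * c < \<delta>"
      using c by (auto simp: field_simps)
    have edge: "((\<lambda>s. h (a + s *\<^sub>R d + r *\<^sub>R k)) has_derivative
        (\<lambda>y. h' (a + s *\<^sub>R d + r *\<^sub>R k) (y *\<^sub>R d))) (at s within {0..t})"
      if "0 \<le> s" "s \<le> t" "0 \<le> r" "r \<le> t" for s r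
      by (rule has_derivative_in_compose2[where t = S, OF der])
        (use that t in \<open>auto intro!: par derivative_eq_intros\<close>)
    have "\<exists>s\<in>{0<..<t}.
        (h (a + t *\<^sub>R d + t *\<^sub>R k) - h (a + t *\<^sub>R d + 0 *\<^sub>R k))
        - (h (a + 0 *\<^sub>R d + t *\<^sub>R k) - h (a + 0 *\<^sub>R d + 0 *\<^sub>R k))
        = h' (a + s *\<^sub>R d + t *\<^sub>R k) ((t - 0) *\<^sub>R d) - h' (a + s *\<^sub>R d + 0 *\<^sub>R k) ((t - 0) *\<^sub>R d)"
      using t(1) by (intro mvt_simple[OF t(1)] has_derivative_diff edge) auto
    then obtain s where s: "0 < s" "s < t" and
      mv: "h (a + t *\<^sub>R d + t *\<^sub>R k) - h (a + t *\<^sub>R d) - h (a + t *\<^sub>R k) + h a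
        = h' (a + s *\<^sub>R d + t *\<^sub>R k) (t *\<^sub>R d) - h' (a + s *\<^sub>R d) (t *\<^sub>R d)"
      by (auto simp: algebra_simps)
    define x y where "x = a + s *\<^sub>R d + t *\<^sub>R k" and "y = a + s *\<^sub>R d"
    have S: "x \<in> S" "y \<in> S"
      using par[of s t] par[of s 0] s t by (auto simp: x_def y_def)
    have scale: "h' z (t *\<^sub>R d) = t * h' z d" if "z \<in> S" for z
      using linear_scale[OF has_derivative_linear[OF der[OF that]]] by simp
    have nx: "norm (x - a) \<le> t * (norm d + norm k)"
    proof -
      have "norm (x - a) \<le> s * norm d + t * norm k"
        using s t norm_triangle_ineq[of "s *\<^sub>R d" "t *\<^sub>R k"] by (simp add: x_def add.assoc)
      also have "\<dots> \<le> t * norm d + t * norm k"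
        using s by (intro add_right_mono mult_right_mono) auto
      finally show ?thesis by (simp add: algebra_simps)
    qed
    have ny: "norm (y - a) \<le> t * norm d"
      using s by (auto simp: y_def intro!: mult_right_mono)
    have "t * (norm d + norm k) < \<delta>" "t * norm d < \<delta>"
      using t(1) by (auto intro!: le_less_trans[OF mult_left_mono t(3)] simp: c_def)
    then have nearx: "\<bar>h' x d - h' a d - L (x - a)\<bar> \<le> \<epsilon> * norm (x - a)"
      and neary: "\<bar>h' y d - h' a d - L (y - a)\<bar> \<le> \<epsilon> * norm (y - a)"
      using near[OF S(1)] near[OF S(2)] nx ny by linarith+
    have Lxy: "L (x - a) - L (y - a) = t * L k"
      by (simp add: x_def y_def L.add L.scaleR add.assoc)
    have "\<bar>(h' x d - h' y d) - t * L k\<bar> \<le> \<epsilon> * norm (x - a) + \<epsilon> * norm (y - a)"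
      using nearx neary Lxy by linarith
    also have "\<dots> \<le> \<epsilon> * (t * (norm d + norm k)) + \<epsilon> * (t * norm d)"
      using nx ny \<epsilon> by (intro add_mono mult_left_mono) auto
    also have "\<dots> < \<epsilon> * t * c"
      using \<epsilon> t by (simp add: c_def algebra_simps)
    also have "\<dots> = e * t"
      using c by (simp add: \<epsilon>_def)
    finally have est: "\<bar>(h' x d - h' y d) - t * L k\<bar> < e * t" .
    have "h (a + t *\<^sub>R d + t *\<^sub>R k) - h (a + t *\<^sub>R d) - h (a + t *\<^sub>R k) + h a = t * (h' x d - h' y d)"
      using mv scale[OF S(1)] scale[OF S(2)] by (simp add: x_def y_def right_diff_distrib)
    then have "(h (a + t *\<^sub>R d + t *\<^sub>R k) - h (a + t *\<^sub>R d) - h (a + t *\<^sub>R k) + h a) / t\<^sup>2 - L k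
        = ((h' x d - h' y d) - t * L k) / t"
      using t(1) by (simp only:) (simp add: field_simps power2_eq_square)
    moreover have "\<bar>((h' x d - h' y d) - t * L k) / t\<bar> < e"
      using est t(1) by (simp add: pos_divide_less_eq)
    ultimately show ?case
      by (simp add: dist_real_def)
  qed
qed

text \<open>The second difference is symmetric in \<open>d\<close> and \<open>k\<close>, so its limit can be computed in two ways.\<close>

lemma second_derivative_symmetric_within:
  fixes h :: "'a::real_normed_vector \<Rightarrow> real"
  assumes der: "\<And>x. x \<in> S \<Longrightarrow> (h has_derivative h' x) (at x within S)"
    and d: "((\<lambda>x. h' x d) has_derivative L) (at a within S)"
    and k: "((\<lambda>x. h' x k) has_derivative M) (at a within S)"
    and par: "\<And>s t. \<lbrakk>0 \<le> s; s \<le> 1; 0 \<le> t; t \<le> 1\<rbrakk> \<Longrightarrow> a + s *\<^sub>R d + t *\<^sub>R k \<in> S"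
  shows "L k = M d"
proof -
  have par': "a + s *\<^sub>R k + t *\<^sub>R d \<in> S" if "0 \<le> s" "s \<le> 1" "0 \<le> t" "t \<le> 1" for s t
    using par[of t s] that by (simp add: algebra_simps)
  have "((\<lambda>t. (h (a + t *\<^sub>R d + t *\<^sub>R k) - h (a + t *\<^sub>R d) - h (a + t *\<^sub>R k) + h a) / t\<^sup>2)
      \<longlongrightarrow> M d) (at_right 0)"
    using second_difference_limit[OF der k par'] by (simp add: algebra_simps)
  with second_difference_limit[OF der d par] show ?thesis
    by (rule tendsto_unique[OF trivial_limit_at_right_real])
qed

section \<open>Rules for partial derivatives relative to a set\<close>

lemma upd_coord_nth [simp]: "upd_coord u j t $ i = (if i = j then t else u $ i)"
  by (simp add: upd_coord_def)

lemma upd_coord_same [simp]: "upd_coord u j (u $ j) = u"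
  by (simp add: vec_eq_iff)

lemma has_partial_on_cong:
  assumes "has_partial_on S j g g'" "\<And>u. u \<in> S \<Longrightarrow> g u = k u" "\<And>u. u \<in> S \<Longrightarrow> g' u = k' u"
  shows "has_partial_on S j k k'"
  unfolding has_partial_on_def
proof
  fix u assume u: "u \<in> S"
  then have "((\<lambda>t. g (upd_coord u j t)) has_real_derivative k' u)
      (at (u $ j) within {t. upd_coord u j t \<in> S})"
    using assms(1,3) by (simp add: has_partial_on_def)
  then show "((\<lambda>t. k (upd_coord u j t)) has_real_derivative k' u)
      (at (u $ j) within {t. upd_coord u j t \<in> S})"
    unfolding has_field_derivative_def
    by (rule has_derivative_transform[rotated 2]) (use u assms(2) in auto)
qed

lemma has_partial_on_eqI:
  assumes "has_partial_on S j g g'" "\<And>u. u \<in> S \<Longrightarrow> g' u = k' u"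
  shows "has_partial_on S j g k'"
  using assms by (simp add: has_partial_on_def)

lemma has_partial_on_const: "has_partial_on S j (\<lambda>u. c) (\<lambda>u. 0)"
  by (simp add: has_partial_on_def)

lemma has_partial_on_nth: "has_partial_on S j (\<lambda>u. u $ i) (\<lambda>u. of_bool (i = j))"
  by (auto simp: has_partial_on_def)

lemma has_partial_on_nth_compose:
  assumes "\<And>u. u \<in> S \<Longrightarrow> (\<phi> has_real_derivative \<phi>' (u $ i)) (at (u $ i))"
  shows "has_partial_on S j (\<lambda>u. \<phi> (u $ i)) (\<lambda>u. of_bool (i = j) * \<phi>' (u $ i))"
  using assms by (cases "i = j") (auto simp: has_partial_on_def intro: has_field_derivative_at_within)

lemma has_partial_on_add:
  assumes "has_partial_on S j f f'" "has_partial_on S j g g'"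
  shows "has_partial_on S j (\<lambda>u. f u + g u) (\<lambda>u. f' u + g' u)"
  using assms by (auto simp: has_partial_on_def intro: DERIV_add)

lemma has_partial_on_diff:
  assumes "has_partial_on S j f f'" "has_partial_on S j g g'"
  shows "has_partial_on S j (\<lambda>u. f u - g u) (\<lambda>u. f' u - g' u)"
  using assms by (auto simp: has_partial_on_def intro: DERIV_diff)

lemma has_partial_on_mult:
  assumes "has_partial_on S j f f'" "has_partial_on S j g g'"
  shows "has_partial_on S j (\<lambda>u. f u * g u) (\<lambda>u. f' u * g u + f u * g' u)"
  unfolding has_partial_on_def
proof
  fix u assume "u \<in> S"
  then show "((\<lambda>t. f (upd_coord u j t) * g (upd_coord u j t)) has_real_derivative
      f' u * g u + f u * g' u) (at (u $ j) within {t. upd_coord u j t \<in> S})"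
    using DERIV_mult[of "\<lambda>t. f (upd_coord u j t)" "f' u" "u $ j" "{t. upd_coord u j t \<in> S}"
        "\<lambda>t. g (upd_coord u j t)" "g' u"] assms
    by (simp add: has_partial_on_def algebra_simps)
qed

lemma has_partials_on_Nil: "has_partials_on S [] D D"
  by simp

lemma has_partials_on_Cons:
  "has_partial_on S j g g' \<Longrightarrow> has_partials_on S js g' D \<Longrightarrow> has_partials_on S (j # js) g D"
  by auto

text \<open>The chain rule for a curve given by its components and a function given by its gradient \<open>G\<close>. The
  curve has to stay in \<open>S\<close> because the derivative of \<open>H\<close> is known only relative to \<open>S\<close>.\<close>

lemma has_real_derivative_along_curve:
  fixes \<gamma> :: "real \<Rightarrow> real ^ 'n" and H :: "real ^ 'n \<Rightarrow> real"
  assumes H: "(H has_derivative (\<lambda>w. \<Sum>i\<in>UNIV. w $ i * G i)) (at (\<gamma> t) within S)"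
    and \<gamma>: "\<gamma> ` T \<subseteq> S"
    and comp: "\<And>i. ((\<lambda>t. \<gamma> t $ i) has_real_derivative \<gamma>' i) (at t within T)"
  shows "((\<lambda>t. H (\<gamma> t)) has_real_derivative (\<Sum>i\<in>UNIV. \<gamma>' i * G i)) (at t within T)"
proof -
  have "(\<gamma> has_derivative (\<lambda>y. y *\<^sub>R (\<chi> i. \<gamma>' i))) (at t within T)"
  proof (rule has_derivative_componentwise_within[THEN iffD2], rule ballI)
    fix b :: "real ^ 'n" assume "b \<in> Basis"
    then have "\<exists>i. b = axis i 1"
      by (auto simp: Basis_vec_def)
    then obtain i where b: "b = axis i 1" ..
    have "(\<lambda>y. (y *\<^sub>R (\<chi> i. \<gamma>' i)) \<bullet> b) = (*) (\<gamma>' i)"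
      by (simp only: b inner_axis vector_scaleR_component vec_lambda_beta inner_real_def
          mult_1_right real_scaleR_def mult_commute_abs)
    moreover have "((\<lambda>t. \<gamma> t \<bullet> b) has_derivative (*) (\<gamma>' i)) (at t within T)"
      using comp[of i] unfolding b has_field_derivative_def inner_axis inner_real_def mult_1_right .
    ultimately show "((\<lambda>t. \<gamma> t \<bullet> b) has_derivative (\<lambda>y. (y *\<^sub>R (\<chi> i. \<gamma>' i)) \<bullet> b)) (at t within T)"
      by (simp only:)
  qed
  from has_derivative_in_compose[OF this has_derivative_subset[OF H \<gamma>]]
  have "((\<lambda>t. H (\<gamma> t)) has_derivative (\<lambda>y. \<Sum>i\<in>UNIV. y * \<gamma>' i * G i)) (at t within T)"
    by simp
  moreover have "(\<lambda>y. \<Sum>i\<in>UNIV. y * \<gamma>' i * G i) = (*) (\<Sum>i\<in>UNIV. \<gamma>' i * G i)"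
    by (rule ext) (simp add: sum_distrib_left mult_ac)
  ultimately show ?thesis
    by (simp only: has_field_derivative_def)
qed

lemma has_partial_on_if_has_derivative:
  fixes H :: "real ^ 'n \<Rightarrow> real"
  assumes "\<And>x. x \<in> S \<Longrightarrow> (H has_derivative (\<lambda>w. \<Sum>i\<in>UNIV. w $ i * G i x)) (at x within S)"
  shows "has_partial_on S j H (G j)"
  unfolding has_partial_on_def
proof
  fix u assume u: "u \<in> S"
  have "((\<lambda>t. H (upd_coord u j t)) has_real_derivative (\<Sum>i\<in>UNIV. of_bool (i = j) * G i u))
      (at (u $ j) within {t. upd_coord u j t \<in> S})"
    by (rule has_real_derivative_along_curve[where S = S])
      (use assms[OF u] in \<open>auto intro!: derivative_eq_intros\<close>)
  then show "((\<lambda>t. H (upd_coord u j t)) has_real_derivative G j u)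
      (at (u $ j) within {t. upd_coord u j t \<in> S})"
    by simp
qed

section \<open>Bounded first and second derivatives on the unit box\<close>

lemma mem_unit_cbox: "x \<in> cbox 0 (1 :: real ^ 'n) \<longleftrightarrow> (\<forall>i. 0 \<le> x $ i \<and> x $ i \<le> 1)"
  by (simp add: mem_box_cart)

text \<open>On a nondegenerate box every coordinate line through a point, a boundary point included, meets the
  box in an interval, where one-sided derivatives are unique.\<close>

lemma has_partial_on_unit_cbox_unique:
  fixes x :: "real ^ 'n"
  assumes "has_partial_on (cbox 0 1) j g g1" "has_partial_on (cbox 0 1) j g g2" "x \<in> cbox 0 1"
  shows "g1 x = g2 x"
proof -
  have line: "{t. upd_coord x j t \<in> cbox 0 1} = {0..1}"
    using assms(3) by (auto simp: mem_unit_cbox split: if_splits)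
  have "x $ j \<in> {0..1}"
    using assms(3) by (simp add: mem_unit_cbox)
  then have nontrivial: "at (x $ j) within {0..1} \<noteq> bot"
    by (simp add: trivial_limit_within)
  have deriv: "((\<lambda>t. g (upd_coord x j t)) has_real_derivative k x) (at (x $ j) within {0..1})"
    if "has_partial_on (cbox 0 1) j g k" for k
    using that[unfolded has_partial_on_def, rule_format, OF assms(3)] unfolding line .
  show ?thesis
    by (rule has_field_derivative_unique[OF deriv[OF assms(1)] deriv[OF assms(2)] nontrivial])
qed

lemma has_derivative_sum_axis:
  fixes H :: "real ^ 'n \<Rightarrow> real"
  assumes "(H has_derivative L) F"
  shows "(H has_derivative (\<lambda>w. \<Sum>i\<in>UNIV. w $ i * L (axis i 1))) F"
proof -
  have lin: "linear L"
    using assms by (rule has_derivative_linear)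
  have "L w = (\<Sum>i\<in>UNIV. w $ i * L (axis i 1))" for w
  proof -
    have "L w = L (\<Sum>i\<in>UNIV. w $ i *s axis i 1)"
      by (simp only: basis_expansion)
    also have "\<dots> = (\<Sum>i\<in>UNIV. w $ i * L (axis i 1))"
      by (simp add: linear_sum[OF lin] scalar_mult_eq_scaleR linear_scale[OF lin])
    finally show ?thesis .
  qed
  then have "(\<lambda>w. \<Sum>i\<in>UNIV. w $ i * L (axis i 1)) = L"
    by (intro ext) (rule sym)
  with assms show ?thesis
    by (simp only:)
qed

text \<open>The assumption on \<open>h\<close> speaks separately of Frechet derivatives and of bounded partial derivatives.
  By uniqueness of partial derivatives the latter are the components of the former. This yields
  gradients, which the chain rule needs, with one common bound and symmetric second derivatives.\<close>

lemma bounded_derivs_upto_2_unit_cboxE: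
  fixes h :: "real ^ 'n \<Rightarrow> real"
  assumes "bounded_derivs_upto_2 h (cbox 0 1)"
  obtains D1 :: "'n \<Rightarrow> real ^ 'n \<Rightarrow> real" and D2 :: "'n \<Rightarrow> 'n \<Rightarrow> real ^ 'n \<Rightarrow> real" and C :: real
  where "\<And>x. x \<in> cbox 0 1 \<Longrightarrow>
            (h has_derivative (\<lambda>w. \<Sum>i\<in>UNIV. w $ i * D1 i x)) (at x within cbox 0 1)"
    and "\<And>i x. x \<in> cbox 0 1 \<Longrightarrow>
            (D1 i has_derivative (\<lambda>w. \<Sum>j\<in>UNIV. w $ j * D2 i j x)) (at x within cbox 0 1)"
    and "\<And>i j x. x \<in> cbox 0 1 \<Longrightarrow> D2 i j x = D2 j i x"
    and "\<And>x. x \<in> cbox 0 1 \<Longrightarrow> \<bar>h x\<bar> \<le> C"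
    and "\<And>i x. x \<in> cbox 0 1 \<Longrightarrow> \<bar>D1 i x\<bar> \<le> C"
    and "\<And>i j x. x \<in> cbox 0 1 \<Longrightarrow> \<bar>D2 i j x\<bar> \<le> C"
proof -
  let ?S = "cbox 0 (1 :: real ^ 'n)"
  obtain h' where h': "\<And>x. x \<in> ?S \<Longrightarrow> (h has_derivative blinfun_apply (h' x)) (at x within ?S)"
    and "h' differentiable_on ?S"
    using assms unfolding bounded_derivs_upto_2_def twice_differentiable_on_def by blast
  then obtain h'' where h'': "\<And>x. x \<in> ?S \<Longrightarrow> (h' has_derivative h'' x) (at x within ?S)"
    unfolding differentiable_on_def differentiable_def by metis
  define D1 where "D1 i x = h' x (axis i 1)" for i x
  define D2 where "D2 i j x = h'' x (axis j 1) (axis i 1)" for i j x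
  have dir: "((\<lambda>x. h' x d) has_derivative (\<lambda>w. h'' x w d)) (at x within ?S)" if "x \<in> ?S" for x d
    using bounded_linear.has_derivative[OF blinfun.bounded_linear_left h''[OF that]] .
  have der1: "(h has_derivative (\<lambda>w. \<Sum>i\<in>UNIV. w $ i * D1 i x)) (at x within ?S)"
    if "x \<in> ?S" for x
    using has_derivative_sum_axis[OF h'[OF that]] by (simp add: D1_def)
  have der2: "(D1 i has_derivative (\<lambda>w. \<Sum>j\<in>UNIV. w $ j * D2 i j x)) (at x within ?S)"
    if "x \<in> ?S" for x i
    using has_derivative_sum_axis[OF dir[OF that, of "axis i 1"]] by (simp add: D1_def[abs_def] D2_def)
  have mixed: "D2 i j x = D2 j i x" if x: "x \<in> ?S" for i j x
  proof (cases "i = j")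
    case False
    \<comment> \<open>A step of length at most one half in direction \<open>\<plusminus> axis k 1\<close> stays in the box if the sign points
      away from the nearer face.\<close>
    define \<sigma> where "\<sigma> k = (if x $ k \<le> 1/2 then 1/2 else -(1/2) :: real)" for k
    have inside: "0 \<le> x $ k + r * \<sigma> k" "x $ k + r * \<sigma> k \<le> 1" if "0 \<le> r" "r \<le> 1" for k r
    proof -
      have "0 \<le> x $ k" "x $ k \<le> 1"
        using x by (simp_all add: mem_unit_cbox)
      then show "0 \<le> x $ k + r * \<sigma> k" "x $ k + r * \<sigma> k \<le> 1"
        using that by (simp_all add: \<sigma>_def)
    qed
    have par: "x + s *\<^sub>R (\<sigma> i *\<^sub>R axis i 1) + t *\<^sub>R (\<sigma> j *\<^sub>R axis j 1) \<in> ?S"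
      if "0 \<le> s" "s \<le> 1" "0 \<le> t" "t \<le> 1" for s t
    proof -
      have "0 \<le> x $ k \<and> x $ k \<le> 1" for k
        using x by (simp add: mem_unit_cbox)
      then show ?thesis
        using False inside[of s i] inside[of t j] that by (simp add: mem_unit_cbox axis_def)
    qed
    have "h'' x (\<sigma> j *\<^sub>R axis j 1) (\<sigma> i *\<^sub>R axis i 1) = h'' x (\<sigma> i *\<^sub>R axis i 1) (\<sigma> j *\<^sub>R axis j 1)"
      by (rule second_derivative_symmetric_within[OF h' dir[OF x] dir[OF x] par])
    then have "\<sigma> j * (\<sigma> i * D2 i j x) = \<sigma> i * (\<sigma> j * D2 j i x)"
      using linear_scale[OF has_derivative_linear[OF h''[OF x]]]
      by (auto simp: D2_def blinfun.bilinear_simps)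
    then show ?thesis
      by (simp add: \<sigma>_def split: if_splits)
  qed auto
  have bdd: "\<exists>D. has_partials_on ?S js h D \<and> bounded (D ` ?S)" if "length js \<le> 2" for js
    using assms that unfolding bounded_derivs_upto_2_def by blast
  have part1: "has_partial_on ?S i h (D1 i)" for i
    by (rule has_partial_on_if_has_derivative) (rule der1)
  have part2: "has_partial_on ?S j (D1 i) (D2 i j)" for i j
    by (rule has_partial_on_if_has_derivative) (rule der2)
  have b0: "bounded (h ` ?S)"
    using bdd[of "[]"] by (auto simp: image_def cong: bex_cong)
  have b1: "bounded (D1 i ` ?S)" for i
  proof -
    obtain g D where g: "has_partial_on ?S i h g" "\<forall>u\<in>?S. D u = g u" "bounded (D ` ?S)"
      using bdd[of "[i]"] by auto
    then have "D ` ?S = D1 i ` ?S"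
      using has_partial_on_unit_cbox_unique[OF part1 g(1)] by (intro image_cong) auto
    then show ?thesis using g(3) by simp
  qed
  have b2: "bounded (D2 i j ` ?S)" for i j
  proof -
    obtain g k D where g: "has_partial_on ?S i h g" "has_partial_on ?S j g k"
        "\<forall>u\<in>?S. D u = k u" "bounded (D ` ?S)"
      using bdd[of "[i, j]"] by auto
    have "has_partial_on ?S j (D1 i) k"
      by (rule has_partial_on_cong[OF g(2)])
        (use has_partial_on_unit_cbox_unique[OF part1 g(1)] in auto)
    then have "D ` ?S = D2 i j ` ?S"
      using has_partial_on_unit_cbox_unique[OF part2] g(3) by (intro image_cong) auto
    then show ?thesis using g(4) by simp
  qed
  let ?U = "h ` ?S \<union> (\<Union>i. D1 i ` ?S) \<union> (\<Union>i. \<Union>j. D2 i j ` ?S)"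
  have "bounded ?U"
    using b0 b1 b2 by (simp add: bounded_UN)
  then obtain C where "\<forall>y\<in>?U. norm y \<le> C"
    unfolding bounded_iff ..
  then have C: "\<bar>y\<bar> \<le> C" if "y \<in> ?U" for y
    using that by simp
  show thesis
    by (rule that[of D1 D2 C, OF der1 der2 mixed C C C]) blast+
qed

section \<open>Products of coordinate powers\<close>

definition half_open_box :: "(real ^ 'n) set" where
  "half_open_box = {u. \<forall>j. 0 < u $ j \<and> u $ j \<le> 1}"

lemma half_open_boxD:
  assumes "u \<in> half_open_box"
  shows "0 < u $ i" "u $ i \<le> 1"
  using assms by (auto simp: half_open_box_def)

text \<open>The right-hand side of the bound on \<open>\<partial>\<^sup>v g\<close> in the definition of a lower edge singularity, without
  its constant.\<close>

definition edge_weight :: "real ^ 'n \<Rightarrow> 'n::finite set \<Rightarrow> real ^ 'n \<Rightarrow> real" where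
  "edge_weight A v u = (\<Prod>j\<in>UNIV. u $ j powr (- A $ j - of_bool (j \<in> v)))"

text \<open>Because \<open>j \<notin> v\<close>, the variable \<open>u\<^sub>j\<close> occurs in the weight with exponent \<open>- A\<^sub>j\<close>. Both terms of
  the product rule contain the weight for \<open>insert j v\<close>: differentiating the power lowers its
  exponent by one, and in the other term one factor \<open>u\<^sub>j\<close> is split off.\<close>

lemma has_partial_on_edge_weight_mult:
  fixes A :: "real ^ 'n"
  assumes k: "has_partial_on half_open_box j k k'" and j: "j \<notin> v"
  shows "has_partial_on half_open_box j (\<lambda>u. edge_weight A v u * k u)
           (\<lambda>u. edge_weight A (insert j v) u * (u $ j * k' u - A $ j * k u))"
  unfolding has_partial_on_def
proof
  fix u :: "real ^ 'n"
  assume u: "u \<in> half_open_box"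
  let ?T = "{t. upd_coord u j t \<in> half_open_box}"
  define c where "c = (\<Prod>i\<in>UNIV - {j}. u $ i powr (- A $ i - of_bool (i \<in> v)))"
  have weight: "edge_weight A v (upd_coord u j t) = t powr (- A $ j) * c" for t
    unfolding edge_weight_def c_def using j
    by (subst prod.remove[of _ j]) (auto intro!: prod.cong)
  have weight': "edge_weight A (insert j v) u = u $ j powr (- A $ j - 1) * c"
    unfolding edge_weight_def c_def
    by (subst prod.remove[of _ j]) (auto intro!: prod.cong)
  have pos: "0 < u $ j"
    using u by (rule half_open_boxD)
  have powr: "((\<lambda>t. t powr (- A $ j)) has_real_derivative - A $ j * u $ j powr (- A $ j - 1)) (at (u $ j) within ?T)"
    by (rule has_field_derivative_at_within[OF has_real_derivative_powr[OF pos]])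
  have k_line: "((\<lambda>t. k (upd_coord u j t)) has_real_derivative k' u) (at (u $ j) within ?T)"
    using k u by (simp add: has_partial_on_def)
  have "((\<lambda>t. t powr (- A $ j) * k (upd_coord u j t) * c) has_real_derivative
      (- A $ j * u $ j powr (- A $ j - 1) * k u + k' u * u $ j powr (- A $ j)) * c) (at (u $ j) within ?T)"
    using DERIV_cmult_right[OF DERIV_mult[OF powr k_line], of c] by simp
  moreover have "u $ j powr (- A $ j) = u $ j * u $ j powr (- A $ j - 1)"
    using pos by (simp add: powr_mult_base)
  ultimately show "((\<lambda>t. edge_weight A v (upd_coord u j t) * k (upd_coord u j t)) has_real_derivative
      edge_weight A (insert j v) u * (u $ j * k' u - A $ j * k u)) (at (u $ j) within ?T)"
    by (simp add: weight weight' algebra_simps)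
qed

section \<open>The transformation of the square onto a triangle\<close>

definition triangle_map :: "real ^ 2 \<Rightarrow> real ^ 2" where
  "triangle_map u = vector [(1 - u $ 1) * sqrt (u $ 2), sqrt (u $ 2)]"

lemma triangle_map_nth [simp]:
  "triangle_map u $ 1 = (1 - u $ 1) * sqrt (u $ 2)" "triangle_map u $ 2 = sqrt (u $ 2)"
  by (simp_all add: triangle_map_def)

lemma triangle_map_in_cbox:
  assumes "u \<in> half_open_box"
  shows "triangle_map u \<in> cbox 0 1"
  using half_open_boxD[OF assms, of 1] half_open_boxD[OF assms, of 2] by (auto simp: mem_unit_cbox forall_2 intro!: mult_le_one)

text \<open>The form \<open>\<surd>x / (2 x)\<close> of the derivative shows that multiplication by \<open>x\<close> makes it bounded near \<open>0\<close>.\<close>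

lemma has_real_derivative_sqrt_within:
  assumes "0 < x"
  shows "(sqrt has_real_derivative sqrt x / (2 * x)) (at x within T)"
proof -
  have "inverse (sqrt x) / 2 = sqrt x / (2 * x)"
    using assms by (simp add: field_simps)
  with has_field_derivative_at_within[OF DERIV_real_sqrt[OF assms]] show ?thesis
    by simp
qed

lemma has_partial_on_pullback:
  fixes H :: "real ^ 2 \<Rightarrow> real"
  assumes "\<And>x. x \<in> cbox 0 1 \<Longrightarrow>
     (H has_derivative (\<lambda>w. \<Sum>i\<in>UNIV. w $ i * G i x)) (at x within cbox 0 1)"
  shows "has_partial_on half_open_box 1 (\<lambda>u. H (triangle_map u))
           (\<lambda>u. - sqrt (u $ 2) * G 1 (triangle_map u))"
    and "has_partial_on half_open_box 2 (\<lambda>u. H (triangle_map u))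
           (\<lambda>u. sqrt (u $ 2) / (2 * u $ 2) *
                ((1 - u $ 1) * G 1 (triangle_map u) + G 2 (triangle_map u)))"
proof -
  show "has_partial_on half_open_box 1 (\<lambda>u. H (triangle_map u))
           (\<lambda>u. - sqrt (u $ 2) * G 1 (triangle_map u))"
    unfolding has_partial_on_def
  proof
    fix u :: "real ^ 2" assume u: "u \<in> half_open_box"
    let ?T = "{t. upd_coord u 1 t \<in> half_open_box}"
    have "((\<lambda>t. H (triangle_map (upd_coord u 1 t))) has_real_derivative
        (\<Sum>i\<in>UNIV. (if i = 1 then - sqrt (u $ 2) else 0) * G i (triangle_map u))) (at (u $ 1) within ?T)"
    proof (rule has_real_derivative_along_curve)
      show "(H has_derivative (\<lambda>w. \<Sum>i\<in>UNIV. w $ i * G i (triangle_map u)))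
          (at (triangle_map (upd_coord u 1 (u $ 1))) within cbox 0 1)"
        using assms triangle_map_in_cbox[OF u] by simp
      show "(\<lambda>t. triangle_map (upd_coord u 1 t)) ` ?T \<subseteq> cbox 0 1"
        using triangle_map_in_cbox by auto
      show "((\<lambda>t. triangle_map (upd_coord u 1 t) $ i) has_real_derivative
          (if i = 1 then - sqrt (u $ 2) else 0)) (at (u $ 1) within ?T)" for i
        using exhaust_2[of i] by (auto intro!: derivative_eq_intros)
    qed
    then show "((\<lambda>t. H (triangle_map (upd_coord u 1 t))) has_real_derivative
        - sqrt (u $ 2) * G 1 (triangle_map u)) (at (u $ 1) within ?T)"
      by (simp add: sum_2)
  qed
  show "has_partial_on half_open_box 2 (\<lambda>u. H (triangle_map u))
           (\<lambda>u. sqrt (u $ 2) / (2 * u $ 2) *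
                ((1 - u $ 1) * G 1 (triangle_map u) + G 2 (triangle_map u)))"
    unfolding has_partial_on_def
  proof
    fix u :: "real ^ 2" assume u: "u \<in> half_open_box"
    let ?T = "{t. upd_coord u 2 t \<in> half_open_box}"
    let ?r = "sqrt (u $ 2) / (2 * u $ 2)"
    have sqrt': "(sqrt has_real_derivative ?r) (at (u $ 2) within ?T)"
      using half_open_boxD(1)[OF u] by (rule has_real_derivative_sqrt_within)
    have "((\<lambda>t. H (triangle_map (upd_coord u 2 t))) has_real_derivative
        (\<Sum>i\<in>UNIV. (if i = 1 then (1 - u $ 1) * ?r else ?r) * G i (triangle_map u)))
        (at (u $ 2) within ?T)"
    proof (rule has_real_derivative_along_curve)
      show "(H has_derivative (\<lambda>w. \<Sum>i\<in>UNIV. w $ i * G i (triangle_map u)))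
          (at (triangle_map (upd_coord u 2 (u $ 2))) within cbox 0 1)"
        using assms triangle_map_in_cbox[OF u] by simp
      show "(\<lambda>t. triangle_map (upd_coord u 2 t)) ` ?T \<subseteq> cbox 0 1"
        using triangle_map_in_cbox by auto
      show "((\<lambda>t. triangle_map (upd_coord u 2 t) $ i) has_real_derivative
          (if i = 1 then (1 - u $ 1) * ?r else ?r)) (at (u $ 2) within ?T)" for i
        using exhaust_2[of i] sqrt' DERIV_cmult[OF sqrt', of "1 - u $ 1"] by auto
    qed
    then show "((\<lambda>t. H (triangle_map (upd_coord u 2 t))) has_real_derivative
        ?r * ((1 - u $ 1) * G 1 (triangle_map u) + G 2 (triangle_map u))) (at (u $ 2) within ?T)"
      by (simp add: sum_2 algebra_simps add_divide_distrib diff_divide_distrib)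
  qed
qed

section \<open>The lower edge singularity of the transformed function\<close>

lemma distinct_list_2_cases:
  fixes js :: "2 list"
  assumes "distinct js"
  shows "js \<in> {[], [1], [2], [1, 2], [2, 1]}"
proof -
  have "length js \<le> 2"
    using card_mono[of "UNIV :: 2 set" "set js"] distinct_card[OF assms] by simp
  show ?thesis
  proof (cases js)
    case (Cons i ks)
    show ?thesis
    proof (cases ks)
      case Nil
      then show ?thesis
        using Cons exhaust_2[of i] by auto
    next
      case (Cons j ls)
      with \<open>js = i # ks\<close> \<open>length js \<le> 2\<close> have "js = [i, j]"
        by simp
      then show ?thesis
        using assms exhaust_2[of i] exhaust_2[of j] by auto
    qed
  qed simp
qed

theorem theorem2:
  fixes A :: real and f g h :: "real ^ 2 \<Rightarrow> real"
  assumes "0 < A" and "A < 1"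
    and "bounded_derivs_upto_2 h (cbox 0 1)"
    and "\<And>x. x \<in> cbox 0 1 \<Longrightarrow> x $ 1 \<noteq> x $ 2 \<Longrightarrow> f x = \<bar>x $ 1 - x $ 2\<bar> powr (- A) * h x"
    and "\<And>u. u \<in> cbox 0 1 \<Longrightarrow> g u = f (vector [(1 - u $ 1) * sqrt (u $ 2), sqrt (u $ 2)])"
  shows "lower_edge_singularity (vector [A, A / 2]) g"
proof -
  obtain D1 :: "2 \<Rightarrow> real ^ 2 \<Rightarrow> real" and D2 :: "2 \<Rightarrow> 2 \<Rightarrow> real ^ 2 \<Rightarrow> real" and C :: real
    where der1: "\<And>x. x \<in> cbox 0 1 \<Longrightarrow>
            (h has_derivative (\<lambda>w. \<Sum>i\<in>UNIV. w $ i * D1 i x)) (at x within cbox 0 1)"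
      and der2: "\<And>i x. x \<in> cbox 0 1 \<Longrightarrow>
            (D1 i has_derivative (\<lambda>w. \<Sum>j\<in>UNIV. w $ j * D2 i j x)) (at x within cbox 0 1)"
      and mixed: "\<And>i j x. x \<in> cbox 0 1 \<Longrightarrow> D2 i j x = D2 j i x"
      and bounds: "\<And>x. x \<in> cbox 0 1 \<Longrightarrow> \<bar>h x\<bar> \<le> C" "\<And>i x. x \<in> cbox 0 1 \<Longrightarrow> \<bar>D1 i x\<bar> \<le> C"
            "\<And>i j x. x \<in> cbox 0 1 \<Longrightarrow> \<bar>D2 i j x\<bar> \<le> C"
  proof (rule bounded_derivs_upto_2_unit_cboxE[OF assms(3)], goal_cases)
    case (1 D1 D2 C)
    from 1(2-7) show ?case
      by (rule 1(1))
  qed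
  let ?Q = "half_open_box :: (real ^ 2) set"
  define a :: "real ^ 2" where "a = vector [A, A / 2]"
  have a: "a $ 1 = A" "a $ 2 = A / 2"
    by (simp_all add: a_def)
  define H where "H u = h (triangle_map u)" for u
  define P where "P i u = D1 i (triangle_map u)" for i u
  define R where "R i j u = D2 i j (triangle_map u)" for i j u
  \<comment> \<open>\<open>K v\<close> is the result of applying the operators \<open>u\<^sub>j \<partial>\<^sub>j - A\<^sub>j\<close> with \<open>j \<in> v\<close> to \<open>H\<close>, where
    \<open>u\<^sub>2\<close> times the derivative of \<open>\<surd>u\<^sub>2\<close> has become \<open>\<surd>u\<^sub>2 / 2\<close>.\<close>
  define K where "K v u =
      (if 1 \<in> v then
         if 2 \<in> v then 1 / 2 * (A\<^sup>2 * H u) - 1 / 2 * (A * (sqrt (u $ 2) * ((1 - u $ 1) * P 1 u + P 2 u)))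
           - 1 / 2 * ((1 - A) * (u $ 1 * (sqrt (u $ 2) * P 1 u)))
           - 1 / 2 * (u $ 1 * (u $ 2 * ((1 - u $ 1) * R 1 1 u + R 1 2 u)))
         else (- A) * H u - u $ 1 * (sqrt (u $ 2) * P 1 u)
       else
         if 2 \<in> v then 1 / 2 * (sqrt (u $ 2) * ((1 - u $ 1) * P 1 u + P 2 u)) - 1 / 2 * (A * H u)
         else H u)" for v :: "2 set" and u :: "real ^ 2"
  define D where "D v u = edge_weight a v u * K v u" for v u

  \<comment> \<open>Naming the derivative of the square root keeps the identities below polynomial.\<close>
  define q where "q u = sqrt (u $ 2) / (2 * u $ 2)" for u :: "real ^ 2"
  have sqrt_eq: "sqrt (u $ 2) = 2 * (u $ 2 * q u)" and sqrt_q: "sqrt (u $ 2) * (q u * x) = x / 2"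
    if "u \<in> ?Q" for u x
    using half_open_boxD(1)[OF that, of 2] by (auto simp: q_def simp flip: mult.assoc)
  have H_partial: "has_partial_on ?Q 1 H (\<lambda>u. - sqrt (u $ 2) * P 1 u)"
      "has_partial_on ?Q 2 H (\<lambda>u. q u * ((1 - u $ 1) * P 1 u + P 2 u))"
    unfolding H_def[abs_def] P_def q_def by (intro has_partial_on_pullback der1; assumption)+
  have P_partial: "has_partial_on ?Q 1 (P i) (\<lambda>u. - sqrt (u $ 2) * R i 1 u)"
      "has_partial_on ?Q 2 (P i) (\<lambda>u. q u * ((1 - u $ 1) * R i 1 u + R i 2 u))" for i
    unfolding P_def[abs_def] R_def q_def by (intro has_partial_on_pullback der2; assumption)+
  have sqrt_partial: "has_partial_on ?Q j (\<lambda>u. sqrt (u $ 2))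
      (\<lambda>u. of_bool (2 = j) * q u)" for j
    unfolding q_def by (rule has_partial_on_nth_compose) (intro has_real_derivative_sqrt_within half_open_boxD)
  note partial_rules = has_partial_on_const has_partial_on_nth sqrt_partial H_partial P_partial
    has_partial_on_add has_partial_on_diff has_partial_on_mult

  have g_eq: "D {} u = g u" if u: "u \<in> ?Q" for u
  proof -
    have pos: "0 < u $ 1" "u $ 1 \<le> 1" "0 < u $ 2" "u $ 2 \<le> 1"
      using half_open_boxD[OF u] by auto
    have "u \<in> cbox 0 1"
      using u by (auto simp: mem_unit_cbox half_open_box_def less_imp_le)
    then have "g u = f (triangle_map u)"
      using assms(5) by (simp add: triangle_map_def)
    also have "\<dots> = (u $ 1 * sqrt (u $ 2)) powr (- A) * h (triangle_map u)"
      using assms(4)[OF triangle_map_in_cbox[OF u]] pos by (simp add: algebra_simps abs_mult)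
    also have "(u $ 1 * sqrt (u $ 2)) powr (- A) = u $ 1 powr (- A) * u $ 2 powr (- (A / 2))"
      using pos by (simp add: powr_mult powr_powr flip: powr_half_sqrt)
    finally show ?thesis
      by (simp add: D_def K_def H_def edge_weight_def UNIV_2 a)
  qed

  have K_empty: "has_partial_on ?Q j (K {}) H'" if "has_partial_on ?Q j H H'" for j H'
    using that by (simp add: K_def[abs_def])
  have D_empty_1: "has_partial_on ?Q 1 (D {}) (D {1})"
    unfolding D_def[abs_def]
    by (rule has_partial_on_eqI[OF has_partial_on_edge_weight_mult[OF K_empty[OF H_partial(1)]]])
      (simp_all add: K_def a)
  have sqrt_sq: "sqrt (u $ 2) * (sqrt (u $ 2) * x) = u $ 2 * x" and abs_eq: "\<bar>u $ 2\<bar> = u $ 2"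
    if "u \<in> ?Q" for u x
    using half_open_boxD(1)[OF that, of 2] by (simp_all flip: mult.assoc)
  \<comment> \<open>The order \<open>2\<close>, \<open>1\<close> produces \<open>R 2 1\<close> where the order \<open>1\<close>, \<open>2\<close> produces \<open>R 1 2\<close>.\<close>
  have R_sym: "R 2 1 u = R 1 2 u" if "u \<in> ?Q" for u
    using mixed[OF triangle_map_in_cbox[OF that]] by (simp add: R_def)
  have D_empty_2: "has_partial_on ?Q 2 (D {}) (D {2})"
    unfolding D_def[abs_def]
    by (rule has_partial_on_eqI[OF has_partial_on_edge_weight_mult[OF K_empty[OF H_partial(2)]]])
      (simp_all add: K_def a sqrt_eq algebra_simps)
  have D_1_2: "has_partial_on ?Q 2 (D {1}) (D {1, 2})"
  proof -
    have "has_partial_on ?Q 2 (\<lambda>u. (- A) * H u - u $ 1 * (sqrt (u $ 2) * P 1 u))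
       (\<lambda>u. - A * (q u * ((1 - u $ 1) * P 1 u + P 2 u))
        - u $ 1 * (q u * P 1 u + ((1 - u $ 1) * R 1 1 u + R 1 2 u) / 2))"
      by (rule has_partial_on_eqI, (rule partial_rules)+) (simp add: sqrt_q)
    moreover have "K {1} = (\<lambda>u. (- A) * H u - u $ 1 * (sqrt (u $ 2) * P 1 u))"
      by (simp add: K_def fun_eq_iff)
    ultimately have "has_partial_on ?Q 2 (K {1})
       (\<lambda>u. - A * (q u * ((1 - u $ 1) * P 1 u + P 2 u))
        - u $ 1 * (q u * P 1 u + ((1 - u $ 1) * R 1 1 u + R 1 2 u) / 2))"
      by (simp only:)
    then show ?thesis
      unfolding D_def[abs_def]
      by (rule has_partial_on_eqI[OF has_partial_on_edge_weight_mult])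
        (simp_all add: K_def a sqrt_eq insert_commute algebra_simps add_divide_distrib diff_divide_distrib
          power2_eq_square)
  qed
  have D_2_1: "has_partial_on ?Q 1 (D {2}) (D {1, 2})"
  proof -
    have "has_partial_on ?Q 1 (\<lambda>u. 1 / 2 * (sqrt (u $ 2) * ((1 - u $ 1) * P 1 u + P 2 u)) - 1 / 2 * (A * H u))
       (\<lambda>u. A / 2 * (sqrt (u $ 2) * P 1 u)
        - 1 / 2 * (sqrt (u $ 2) * P 1 u)
        - 1 / 2 * (u $ 2 * ((1 - u $ 1) * R 1 1 u + R 1 2 u)))"
      by (rule has_partial_on_eqI, (rule partial_rules)+)
        (simp add: sqrt_sq abs_eq R_sym algebra_simps)
    moreover have "K {2} = (\<lambda>u. 1 / 2 * (sqrt (u $ 2) * ((1 - u $ 1) * P 1 u + P 2 u)) - 1 / 2 * (A * H u))"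
      by (simp add: K_def fun_eq_iff)
    ultimately have "has_partial_on ?Q 1 (K {2})
       (\<lambda>u. A / 2 * (sqrt (u $ 2) * P 1 u)
        - 1 / 2 * (sqrt (u $ 2) * P 1 u)
        - 1 / 2 * (u $ 2 * ((1 - u $ 1) * R 1 1 u + R 1 2 u)))"
      by (simp only:)
    then show ?thesis
      unfolding D_def[abs_def]
      by (rule has_partial_on_eqI[OF has_partial_on_edge_weight_mult])
        (simp_all add: K_def a algebra_simps power2_eq_square)
  qed

  have partials: "has_partials_on ?Q js g (D (set js))" if "distinct js" for js
  proof -
    have "has_partial_on ?Q 1 g (D {1})" "has_partial_on ?Q 2 g (D {2})"
      using has_partial_on_cong[OF D_empty_1 g_eq refl] has_partial_on_cong[OF D_empty_2 g_eq refl] by auto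
    then have "has_partials_on ?Q [1] g (D {1})" "has_partials_on ?Q [2] g (D {2})"
        "has_partials_on ?Q [1, 2] g (D {1, 2})" "has_partials_on ?Q [2, 1] g (D {1, 2})"
      using D_1_2 D_2_1 by (blast intro: has_partials_on_Nil has_partials_on_Cons)+
    moreover have "has_partials_on ?Q [] g (D {})"
      using g_eq by simp
    ultimately show ?thesis
      using distinct_list_2_cases[OF that] by (auto simp: insert_commute simp del: has_partials_on.simps)
  qed

  have bound: "\<bar>D v u\<bar> \<le> 3 * C * edge_weight a v u" if u: "u \<in> ?Q" for v u
  proof -
    have shrink: "\<bar>c * x\<bar> \<le> y" if "\<bar>c\<bar> \<le> 1" "\<bar>x\<bar> \<le> y" for c x y :: real
      using mult_mono[OF that] that by (simp add: abs_mult)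
    \<comment> \<open>Every coefficient in \<open>K\<close> other than the factor \<open>1 / 2\<close> lies between \<open>-1\<close> and \<open>1\<close>.\<close>
    have unit: "\<bar>u $ 1\<bar> \<le> 1" "\<bar>u $ 2\<bar> \<le> 1" "\<bar>1 - u $ 1\<bar> \<le> 1" "\<bar>sqrt (u $ 2)\<bar> \<le> 1"
        "\<bar>A\<bar> \<le> 1" "\<bar>A\<^sup>2\<bar> \<le> 1" "\<bar>1 - A\<bar> \<le> 1"
      using half_open_boxD[OF u, of 1] half_open_boxD[OF u, of 2] assms(1,2)
      by (auto simp: power_le_one)
    have H: "\<bar>H u\<bar> \<le> C" and P: "\<bar>P i u\<bar> \<le> C" and R: "\<bar>R i j u\<bar> \<le> C" for i j
      using bounds triangle_map_in_cbox[OF u] by (auto simp: H_def P_def R_def)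
    have sum: "\<bar>(1 - u $ 1) * x + y\<bar> \<le> 2 * C" if "\<bar>x\<bar> \<le> C" "\<bar>y\<bar> \<le> C" for x y
      using shrink[OF unit(3) that(1)] that(2) by linarith
    define x where "x = sqrt (u $ 2) * ((1 - u $ 1) * P 1 u + P 2 u)"
    define y where "y = u $ 1 * (sqrt (u $ 2) * P 1 u)"
    define z where "z = u $ 1 * (u $ 2 * ((1 - u $ 1) * R 1 1 u + R 1 2 u))"
    have x: "\<bar>x\<bar> \<le> 2 * C" and y: "\<bar>y\<bar> \<le> C" and z: "\<bar>z\<bar> \<le> 2 * C"
      unfolding x_def y_def z_def by (intro shrink unit sum P R)+
    have K: "K v u = (if 1 \<in> v then
         if 2 \<in> v then 1 / 2 * (A\<^sup>2 * H u) - 1 / 2 * (A * x) - 1 / 2 * ((1 - A) * y) - 1 / 2 * z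
         else - (A * H u) - y
       else if 2 \<in> v then 1 / 2 * x - 1 / 2 * (A * H u) else H u)"
      unfolding K_def x_def y_def z_def by simp
    \<comment> \<open>The largest case is \<open>v = {1, 2}\<close>, where the four terms contribute \<open>C/2 + C + C/2 + C\<close>.\<close>
    note terms = H x y z shrink[OF unit(5) H] shrink[OF unit(6) H] shrink[OF unit(5) x]
      shrink[OF unit(7) y]
    have "\<bar>1 / 2 * (A\<^sup>2 * H u) - 1 / 2 * (A * x) - 1 / 2 * ((1 - A) * y) - 1 / 2 * z\<bar> \<le> 3 * C"
      using terms by linarith
    moreover have "\<bar>- (A * H u) - y\<bar> \<le> 3 * C" "\<bar>1 / 2 * x - 1 / 2 * (A * H u)\<bar> \<le> 3 * C" "\<bar>H u\<bar> \<le> 3 * C"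
      using terms by linarith+
    ultimately have "\<bar>K v u\<bar> \<le> 3 * C"
      by (simp only: K split: if_split) simp
    moreover have "0 \<le> edge_weight a v u"
      unfolding edge_weight_def by (intro prod_nonneg) simp
    ultimately show ?thesis
      using mult_left_mono[of "\<bar>K v u\<bar>" "3 * C" "edge_weight a v u"]
      by (simp add: D_def abs_mult mult.commute)
  qed

  have "0 < a $ j \<and> a $ j < 1" for j
    using exhaust_2[of j] a assms(1,2) by auto
  moreover have "\<forall>v. (\<forall>js. distinct js \<and> set js = v \<longrightarrow> has_partials_on ?Q js g (D v)) \<and>
      (\<forall>u\<in>?Q. \<bar>D v u\<bar> \<le> 3 * C * (\<Prod>j\<in>UNIV. u $ j powr (- a $ j - of_bool (j \<in> v))))"
    using partials bound by (auto simp: edge_weight_def)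
  ultimately have "lower_edge_singularity a g"
    unfolding lower_edge_singularity_def Let_def half_open_box_def[symmetric] by blast
  then show ?thesis
    by (simp add: a_def)
qed

end
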